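(* Let $\varphi:\mathbb{R}^m\to\mathbb{R}$ be a convex function such that the problem $\min_{\theta\in\mathbb{R}^m}\varphi(\theta)$ has finite optimal cost $\varphi^\star$ and at least one optimal solution $\theta^\star\in\mathbb{R}^m$, so that $\varphi^\star=\varphi(\theta^\star)$. Let $\mathbb{R}^m=\mathbb{R}^{m_1}\times\cdots\times\mathbb{R}^{m_B}$ with $m=\sum_{\ell=1}^B m_\ell$, and write $\theta=(\theta_1,\dots,\theta_B)$ with $\theta_\ell\in\mathbb{R}^{m_\ell}$. Let $\widetilde\nabla\varphi(\theta)$ denote a subgradient of $\varphi$ at $\theta$ and $[\widetilde\nabla\varphi(\theta)]_\ell$ its $\ell$-th block, and assume that the subgradients of $\varphi$ are block-wise bounded, i.e., for every $\ell\in\{1,\dots,B\}$ there exists $C_\ell>0$ such that $\|[\widetilde\nabla\varphi(\theta)]_\ell\|\le C_\ell$ for all $\theta\in\mathbb{R}^m$. Let $B^t\subseteq\{1,\dots,B\}$, $t\ge0$, be random index sets following the block-selection model described in the context, and let the step-sizes satisfy $\alpha^t\ge0$, $\sum_{t=0}^\infty\alpha^t=\infty$, $\sum_{t=0}^\infty(\alpha^t)^2<\infty$. Consider a sequence $\{\theta^t\}_{t\ge0}$ generated, from any initial $\theta^0\in\mathbb{R}^m$, by $$\theta_\ell^{t+1}=\begin{cases}\theta_\ell^t-\alpha^t[\widetilde\nabla\varphi(\theta^t)]_\ell,&\text{if }\ell\in B^t,\\ \theta_\ell^t,&\text{if }\ell\notin B^t,\end{cases}\qquad \ell\in\{1,\dots,B\}.$$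 Then, almost surely, $\lim_{t\to\infty}\varphi(\theta^t)=\varphi^\star$.
   Context: Block-selection model. At each iteration $t$, each block $\ell\in\{1,\dots,B\}$ is updated with a probability $\sigma_\ell>0$; the probabilities may differ between blocks and several blocks may be updated simultaneously. $B^t\subseteq\{1,\dots,B\}$ is the index set of the blocks selected at time $t$. For each $\ell\in\{1,\dots,B\}$ and $t\ge0$, $\nu_\ell^t$ is the Bernoulli random variable equal to $1$ if $\ell\in B^t$ and $0$ otherwise (so $\nu_\ell^t=1$ with probability $\sigma_\ell$). Assumption: for each $\ell\in\{1,\dots,B\}$ the random variables $\{\nu_\ell^t\}_{t\ge0}$ are independent and identically distributed; moreover, for each $t\ge0$ the random variables $\{\nu_\ell^t\}_{\ell\in\{1,\dots,B\}}$ are mutually independent. $\|\cdot\|$ is the Euclidean norm.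
   Formalization: The formal theorem additionally assumes that the random index sets B^t at different times t are mutually independent; the stated independence over t for each block and over blocks for each t does not imply this, and the claim can fail without it. *)

theory Defs
  imports "HOL-Probability.Probability"
begin

definition is_subgradient :: "('a::real_inner \<Rightarrow> real) \<Rightarrow> 'a \<Rightarrow> 'a \<Rightarrow> bool" where
  "is_subgradient f x g \<longleftrightarrow> (\<forall>y. f x + g \<bullet> (y - x) \<le> f y)"

(* A block decomposition R^m = R^(m_1) x ... x R^(m_B) is given by a map blk from coordinates
   to block indices, so m_l = card {i. blk i = l}.  The l-th block of x is represented inside
   R^m, with zeros in all other coordinates; its norm is the Euclidean norm of the block. *)
definition block :: "('m::finite \<Rightarrow> nat) \<Rightarrow> nat \<Rightarrow> real ^ 'm \<Rightarrow> real ^ 'm" where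
  "block blk l x = (\<chi> i. if blk i = l then x $ i else 0)"

definition sel_indicator :: "(nat \<Rightarrow> 'w \<Rightarrow> nat set) \<Rightarrow> nat \<Rightarrow> nat \<Rightarrow> 'w \<Rightarrow> real" where
  "sel_indicator S l t w = (if l \<in> S t w then 1 else 0)"

(* S t is the random set of blocks updated at time t.  The assumption selection_indep says that
   the sets drawn at different times are independent.  The two preceding assumptions do not
   imply it: a block could otherwise depend on the past selections of another block, and
   convergence of the block subgradient method may then fail.  Identical distribution over t
   is part of sel_prob, as sigma does not depend on t. *)
locale block_selection = prob_space M for M :: "'w measure" +
  fixes B :: nat and \<sigma> :: "nat \<Rightarrow> real" and S :: "nat \<Rightarrow> 'w \<Rightarrow> nat set"
  assumes sel_measurable: "\<And>t. S t \<in> M \<rightarrow>\<^sub>M count_space (Pow {1..B})"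
    and sel_prob_pos: "\<And>l. l \<in> {1..B} \<Longrightarrow> \<sigma> l > 0"
    and sel_prob: "\<And>l t. l \<in> {1..B} \<Longrightarrow> prob {w \<in> space M. sel_indicator S l t w = 1} = \<sigma> l"
    and indep_over_time:
      "\<And>l. l \<in> {1..B} \<Longrightarrow> indep_vars (\<lambda>_. borel) (\<lambda>t. sel_indicator S l t) UNIV"
    and indep_over_blocks:
      "\<And>t. indep_vars (\<lambda>_. borel) (\<lambda>l. sel_indicator S l t) {1..B}"
    and selection_indep: "indep_vars (\<lambda>_. count_space (Pow {1..B})) S UNIV"

end

(* With V x = sum_i (x_i - xstar_i)^2 / sigma(block of i), the weights cancel the selection
   probabilities: since the blocks selected at time t are independent of the iterate at time t,
   E V(theta^(t+1)) <= E V(theta^t) - 2 alpha^t E (phi(theta^t) - phistar) + G^2 (alpha^t)^2.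
   Summing over t and using monotone convergence, sum_t alpha^t (phi(theta^t) - phistar) is
   finite almost surely, so no supermartingale convergence theorem is needed.  As phi is
   Lipschitz, the gap phi(theta^t) - phistar changes by O(alpha^t) in one step; since
   sum_t alpha^t diverges, the gap must then tend to 0.  The subgradient selection is arbitrary,
   possibly non-measurable; this is harmless because the iterate at time t is a function of the
   first t selections and takes only finitely many values. *)
theory Submission
  imports Defs
begin

text \<open>If \<open>a\<close> stayed above \<open>r / 2\<close> from some late time on, the finite
  weighted sum would bound the step-size sum. So a late value of at least \<open>r\<close> must
  later fall below \<open>r / 2\<close>, and the Cauchy tail of the weighted sum leaves too little
  step size for that fall.\<close>

lemma tendsto_zero_if_weighted_summable:
  fixes a \<alpha> :: "nat \<Rightarrow> real"
  assumes a_nonneg: "\<And>t. 0 \<le> a t" and \<alpha>_nonneg: "\<And>t. 0 \<le> \<alpha> t"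
    and increment: "\<And>t. \<bar>a (Suc t) - a t\<bar> \<le> L * \<alpha> t"
    and weighted: "summable (\<lambda>t. \<alpha> t * a t)"
    and divergent: "filterlim (\<lambda>n. \<Sum>t<n. \<alpha> t) at_top sequentially"
  shows "a \<longlonglongrightarrow> 0"
proof (rule LIMSEQ_I)
  fix r :: real assume r: "0 < r"
  \<comment> \<open>\<open>L\<close> is not assumed positive, while \<open>e\<close> divides by
    \<open>K\<close>. The choice of \<open>e\<close> makes \<open>K * (2 * e / r)\<close> equal to
    \<open>r / 2\<close>, the height of the fall to be excluded.\<close>
  define K where "K = max L 1"
  define e where "e = r\<^sup>2 / (4 * K)"
  have K: "0 < K" and e: "0 < e" using r by (auto simp: K_def e_def)
  have step: "\<bar>a (Suc t) - a t\<bar> \<le> K * \<alpha> t" for t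
    using increment[of t] mult_right_mono[of L K "\<alpha> t"] \<alpha>_nonneg[of t]
    by (simp add: K_def)
  have drop: "a s - a n \<le> K * (\<Sum>t=s..<n. \<alpha> t)" if "s \<le> n" for s n
    using that
  proof (induction n rule: dec_induct)
    case (step n)
    then show ?case using \<open>\<And>t. \<bar>a (Suc t) - a t\<bar> \<le> K * \<alpha> t\<close>[of n]
      by (simp add: distrib_left)
  qed simp
  obtain N where N: "\<And>m n. m \<ge> N \<Longrightarrow> norm (\<Sum>t=m..<n. \<alpha> t * a t) < e"
    using weighted e unfolding summable_Cauchy by blast
  have above: "(\<Sum>t=s..<n. \<alpha> t) \<le> 2 * e / r"
    if "s \<ge> N" "\<And>t. s \<le> t \<Longrightarrow> t < n \<Longrightarrow> r / 2 \<le> a t" for s n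
  proof -
    have "(\<Sum>t=s..<n. \<alpha> t) * (r / 2) = (\<Sum>t=s..<n. \<alpha> t * (r / 2))"
      by (rule sum_distrib_right)
    also have "\<dots> \<le> (\<Sum>t=s..<n. \<alpha> t * a t)"
      using that \<alpha>_nonneg by (intro sum_mono mult_left_mono) auto
    also have "\<dots> \<le> e" using N[OF \<open>s \<ge> N\<close>, of n] by simp
    finally show ?thesis using r by (simp add: field_simps)
  qed
  \<comment> \<open>Falling from r to r / 2 needs a step-size total of at least r / (2 K), along which the
    weighted sum grows by at least e.\<close>
  have "a s < r" if s: "s \<ge> N" for s
  proof (rule ccontr)
    assume "\<not> a s < r"
    have "\<exists>n\<ge>s. a n < r / 2"
    proof (rule ccontr)
      assume "\<not> ?thesis"
      then have "(\<Sum>t=s..<n. \<alpha> t) \<le> 2 * e / r" for n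
        using s by (intro above) (auto simp: not_less)
      \<comment> \<open>An inequality, so that \<open>n < s\<close> is covered too, where the last
        sum is empty.\<close>
      moreover have "(\<Sum>t<n. \<alpha> t) \<le> (\<Sum>t<s. \<alpha> t) + (\<Sum>t=s..<n. \<alpha> t)" for n
      proof -
        have "(\<Sum>t<n. \<alpha> t) \<le> sum \<alpha> ({..<s} \<union> {s..<n})"
          using \<alpha>_nonneg by (intro sum_mono2) auto
        also have "\<dots> = (\<Sum>t<s. \<alpha> t) + (\<Sum>t=s..<n. \<alpha> t)"
          by (intro sum.union_disjoint) auto
        finally show ?thesis .
      qed
      ultimately have "(\<Sum>t<n. \<alpha> t) \<le> (\<Sum>t<s. \<alpha> t) + 2 * e / r" for n
        by (meson add_left_mono order_trans)
      moreover obtain n where "(\<Sum>t<n. \<alpha> t) \<ge> (\<Sum>t<s. \<alpha> t) + 2 * e / r + 1"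
        using divergent unfolding filterlim_at_top eventually_sequentially by blast
      ultimately show False by (smt (verit))
    qed
    then obtain m where m: "m \<ge> s" "a m < r / 2" by blast
    \<comment> \<open>Taking the first such time keeps \<open>a\<close> at or above
      \<open>r / 2\<close> on all of \<open>{s..<n}\<close>, as \<open>above\<close>
      requires.\<close>
    define n where "n = (LEAST n. n \<ge> s \<and> a n < r / 2)"
    have n: "n \<ge> s" "a n < r / 2"
      using LeastI[of "\<lambda>n. n \<ge> s \<and> a n < r / 2" m] m by (auto simp: n_def)
    have "r / 2 \<le> a t" if "s \<le> t" "t < n" for t
      using not_less_Least[of t "\<lambda>n. n \<ge> s \<and> a n < r / 2"] that by (auto simp: n_def)
    then have "(\<Sum>t=s..<n. \<alpha> t) \<le> 2 * e / r" using s by (intro above)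
    then have "K * (\<Sum>t=s..<n. \<alpha> t) \<le> K * (2 * e / r)"
      using K by (intro mult_left_mono) auto
    also have "\<dots> = r / 2"
      using K r by (simp add: e_def field_simps power2_eq_square)
    finally show False
      using drop[OF n(1)] n(2) \<open>\<not> a s < r\<close> by simp
  qed
  then show "\<exists>N. \<forall>n\<ge>N. norm (a n - 0) < r"
    using a_nonneg by (intro exI[of _ N]) auto
qed

text \<open>A finite discrete codomain makes every \<open>h\<close> bounded and measurable, which is
  what admits an arbitrary subgradient selection later.\<close>

lemma (in prob_space) integrable_finite_valued:
  fixes h :: "'b \<Rightarrow> real"
  assumes "X \<in> M \<rightarrow>\<^sub>M count_space A" and "finite A"
  shows "integrable M (\<lambda>w. h (X w))"
proof (rule integrable_const_bound)
  show "AE w in M. norm (h (X w)) \<le> (\<Sum>x\<in>A. norm (h x))"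
    using measurable_space[OF assms(1)] \<open>finite A\<close>
    by (intro AE_I2 member_le_sum[of _ A "\<lambda>x. norm (h x)"]) auto
  show "(\<lambda>w. h (X w)) \<in> borel_measurable M"
    using assms(1) by (rule measurable_compose) simp
qed

section \<open>Independence of the current selection from the past\<close>

context block_selection
begin

text \<open>A finite product of finite discrete spaces is discrete, so every function of a finite
  history is measurable.\<close>

lemma history_space:
  "PiM A (\<lambda>_. count_space (Pow {1..B})) = count_space (PiE A (\<lambda>_. Pow {1..B}))" if "finite A"
  using that by (intro count_space_PiM_finite) (auto intro: countable_finite)

lemma history_measurable:
  "(\<lambda>w. restrict (\<lambda>s. S s w) A) \<in>
    M \<rightarrow>\<^sub>M count_space (PiE A (\<lambda>_. Pow {1..B}))" if "finite A"
proof -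
  have "(\<lambda>w. restrict (\<lambda>s. S s w) A) \<in> M \<rightarrow>\<^sub>M PiM A (\<lambda>_. count_space (Pow {1..B}))"
    using sel_measurable by (intro measurable_restrict) auto
  then show ?thesis
    by (simp only: history_space[OF that])
qed

lemma integrable_history:
  fixes h :: "(nat \<Rightarrow> nat set) \<Rightarrow> real"
  shows "integrable M (\<lambda>w. h (restrict (\<lambda>s. S s w) {..<t}))"
  by (rule integrable_finite_valued[OF history_measurable]) (auto intro: finite_PiE)

text \<open>Time \<open>t\<close> and the times in \<open>{..<t}\<close> are disjoint index sets of
  one independent family, so the expectation factors. Independence of the whole sets
  \<open>S t\<close> matters here, since the history involves all blocks and not only
  \<open>l\<close>.\<close>

lemma expectation_selected:
  fixes h :: "(nat \<Rightarrow> nat set) \<Rightarrow> real"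
  assumes l: "l \<in> {1..B}"
  shows "expectation (\<lambda>w. sel_indicator S l t w * h (restrict (\<lambda>s. S s w) {..<t})) =
    \<sigma> l * expectation (\<lambda>w. h (restrict (\<lambda>s. S s w) {..<t}))"
proof -
  let ?N = "\<lambda>A::nat set. PiM A (\<lambda>_. count_space (Pow {1..B}))"
  have "indep_var (?N {t}) (\<lambda>w. restrict (\<lambda>s. S s w) {t})
      (?N {..<t}) (\<lambda>w. restrict (\<lambda>s. S s w) {..<t})"
    using selection_indep by (rule indep_var_restrict) auto
  then have "indep_var borel ((\<lambda>f. if l \<in> f t then 1 else 0 :: real) \<circ> (\<lambda>w. restrict (\<lambda>s. S s w) {t}))
      borel (h \<circ> (\<lambda>w. restrict (\<lambda>s. S s w) {..<t}))"
    by (rule indep_var_compose) (simp_all add: history_space[simplified])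
  then have indep: "indep_var borel (sel_indicator S l t)
      borel (\<lambda>w. h (restrict (\<lambda>s. S s w) {..<t}))"
    by (simp add: comp_def sel_indicator_def[abs_def])
  have meas: "sel_indicator S l t \<in> borel_measurable M"
    using indep_var_rv1[OF indep] .
  have "expectation (sel_indicator S l t) =
      expectation (indicator {w \<in> space M. sel_indicator S l t w = 1})"
    by (intro Bochner_Integration.integral_cong) (auto simp: sel_indicator_def indicator_def)
  also have "\<dots> = \<sigma> l"
    using sel_prob[OF l, of t] meas by simp
  finally have "expectation (sel_indicator S l t) = \<sigma> l" .
  moreover have "integrable M (sel_indicator S l t)"
    using meas by (intro integrable_const_bound[of _ 1]) (auto simp: sel_indicator_def)
  ultimately show ?thesis
    using indep_var_lebesgue_integral[OF indep _ integrable_history] by (simp only:)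
qed

end

text \<open>The recursion is driven by a deterministic selection sequence \<open>f\<close>, so that
  the random iterate becomes a fixed function of the selections made so far.\<close>

primrec block_iterate ::
  "('m::finite \<Rightarrow> nat) \<Rightarrow> (real ^ 'm \<Rightarrow> real ^ 'm) \<Rightarrow> (nat \<Rightarrow> real) \<Rightarrow> real ^ 'm \<Rightarrow>
    nat \<Rightarrow> (nat \<Rightarrow> nat set) \<Rightarrow> real ^ 'm" where
  "block_iterate blk g \<alpha> x0 0 = (\<lambda>f. x0)"
| "block_iterate blk g \<alpha> x0 (Suc t) = (\<lambda>f. let x = block_iterate blk g \<alpha> x0 t f in
    (\<chi> i. x $ i - (if blk i \<in> f t then \<alpha> t * g x $ i else 0)))"

lemma block_iterate_cong:
  "(\<And>s. s < t \<Longrightarrow> f s = f' s) \<Longrightarrow>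
    block_iterate blk g \<alpha> x0 t f = block_iterate blk g \<alpha> x0 t f'"
  by (induction t) (simp_all add: Let_def cong: if_cong)

lemma block_iterate_restrict:
  "block_iterate blk g \<alpha> x0 t (restrict f {..<t}) = block_iterate blk g \<alpha> x0 t f"
  by (rule block_iterate_cong) simp

text \<open>For nonnegative terms, sum and integral may be exchanged. The total then has a finite
  integral and is finite almost everywhere.\<close>

lemma AE_summable_if_expectation_bounded:
  fixes f :: "nat \<Rightarrow> 'w \<Rightarrow> real"
  assumes int: "\<And>t. integrable M (f t)" and nonneg: "\<And>t w. w \<in> space M \<Longrightarrow> 0 \<le> f t w"
    and bound: "\<And>n. (\<Sum>t<n. integral\<^sup>L M (f t)) \<le> K"
  shows "AE w in M. summable (\<lambda>t. f t w)"
proof -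
  have nn: "0 \<le> integral\<^sup>L M (f t)" for t
    using nonneg by (intro Bochner_Integration.integral_nonneg) auto
  have "(\<integral>\<^sup>+ w. (\<Sum>t. ennreal (f t w)) \<partial>M) = (\<Sum>t. \<integral>\<^sup>+ w. ennreal (f t w) \<partial>M)"
    using int by (intro nn_integral_suminf) auto
  also have "\<dots> = (\<Sum>t. ennreal (integral\<^sup>L M (f t)))"
    using int nonneg by (simp add: nn_integral_eq_integral)
  also have "\<dots> \<noteq> \<top>"
  proof -
    have "summable (\<lambda>t. integral\<^sup>L M (f t))"
      using nn bound by (intro summableI_nonneg_bounded)
    then show ?thesis using nn by (simp add: suminf_ennreal2)
  qed
  finally have "AE w in M. (\<Sum>t. ennreal (f t w)) \<noteq> \<infinity>"
    using int by (intro nn_integral_PInf_AE) auto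
  then show ?thesis
    using AE_space
  proof eventually_elim
    case (elim w)
    then show ?case
      using nonneg[of w] by (intro summable_suminf_not_top) auto
  qed
qed

theorem mainTheorem2:
  fixes \<phi> :: "real ^ 'm::finite \<Rightarrow> real" and \<phi>star :: real and \<theta>star :: "real ^ 'm"
    and B :: nat and blk :: "'m \<Rightarrow> nat"
    and subgrad :: "real ^ 'm \<Rightarrow> real ^ 'm" and C :: "nat \<Rightarrow> real"
    and M :: "'w measure" and \<sigma> :: "nat \<Rightarrow> real" and S :: "nat \<Rightarrow> 'w \<Rightarrow> nat set"
    and \<alpha> :: "nat \<Rightarrow> real" and \<theta>0 :: "real ^ 'm" and \<theta> :: "nat \<Rightarrow> 'w \<Rightarrow> real ^ 'm"
  assumes convex: "convex_on UNIV \<phi>"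
    and finite_cost: "bdd_below (range \<phi>)" and optimal_cost: "\<phi>star = (INF x. \<phi> x)"
    and optimal_solution: "\<phi> \<theta>star = \<phi>star"
    and blocks: "\<And>i. blk i \<in> {1..B}"
    and subgradient: "\<And>x. is_subgradient \<phi> x (subgrad x)"
    and bounded_blocks:
      "\<And>l. l \<in> {1..B} \<Longrightarrow> C l > 0"
      "\<And>l x. l \<in> {1..B} \<Longrightarrow> norm (block blk l (subgrad x)) \<le> C l"
    and selection: "block_selection M B \<sigma> S"
    and stepsize_nonneg: "\<And>t. \<alpha> t \<ge> 0"
    and stepsize_sum: "filterlim (\<lambda>n. \<Sum>t<n. \<alpha> t) at_top sequentially"
    and stepsize_square_sum: "summable (\<lambda>t. (\<alpha> t)\<^sup>2)"
    and initial: "\<And>w. w \<in> space M \<Longrightarrow> \<theta> 0 w = \<theta>0"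
    and update: "\<And>t w l. w \<in> space M \<Longrightarrow> l \<in> {1..B} \<Longrightarrow>
      block blk l (\<theta> (Suc t) w) =
        (if l \<in> S t w
         then block blk l (\<theta> t w) - \<alpha> t *\<^sub>R block blk l (subgrad (\<theta> t w))
         else block blk l (\<theta> t w))"
  shows "AE w in M. (\<lambda>t. \<phi> (\<theta> t w)) \<longlonglongrightarrow> \<phi>star"
proof -
  interpret block_selection M B \<sigma> S by (rule selection)
  \<comment> \<open>A crude bound: the Euclidean norm is at most the sum of the absolute
    coordinates, each bounded by the constant of its block.\<close>
  define G where "G = (\<Sum>i\<in>UNIV. C (blk i))"
  have G: "norm (subgrad x) \<le> G" for x
  proof -
    have "\<bar>subgrad x $ i\<bar> \<le> C (blk i)" for i
      using component_le_norm_cart[of "block blk (blk i) (subgrad x)" i]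
        bounded_blocks(2)[OF blocks, of i x] by (simp add: block_def)
    then show ?thesis
      unfolding G_def by (intro order_trans[OF norm_le_l1_cart] sum_mono)
  qed
  have G_nonneg: "0 \<le> G" using G[of 0] norm_ge_zero order_trans by blast
  have lower: "\<phi>star \<le> \<phi> x" for x
    unfolding optimal_cost using finite_cost by (intro cINF_lower) auto
  have sub: "\<phi> x + subgrad x \<bullet> (y - x) \<le> \<phi> y" for x y
    using subgradient by (auto simp: is_subgradient_def)
  have lipschitz: "\<bar>\<phi> y - \<phi> x\<bar> \<le> G * norm (y - x)" for x y
  proof -
    \<comment> \<open>The subgradient inequality at \<open>x\<close> bounds one sign of the
      difference; exchanging the points gives the other.\<close>
    have "\<phi> x - \<phi> y \<le> G * norm (y - x)" for x y
    proof -
      have "\<phi> x - \<phi> y \<le> - (subgrad x \<bullet> (y - x))" using sub[of x y] by simp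
      also have "\<dots> \<le> norm (subgrad x) * norm (y - x)"
        using Cauchy_Schwarz_ineq2[of "subgrad x" "y - x"] by linarith
      also have "\<dots> \<le> G * norm (y - x)" using G by (intro mult_right_mono) auto
      finally show ?thesis .
    qed
    from this[of x y] this[of y x] show ?thesis by (simp add: norm_minus_commute)
  qed

  \<comment> \<open>Iterates as functions of the selection history\<close>
  have coord: "\<theta> (Suc t) w $ i =
      \<theta> t w $ i - sel_indicator S (blk i) t w * (\<alpha> t * subgrad (\<theta> t w) $ i)"
    if "w \<in> space M" for t w i
    using arg_cong[OF update[OF that blocks[of i], of t], of "\<lambda>x. x $ i"]
    by (auto simp: block_def sel_indicator_def split: if_splits)
  have iterate: "\<theta> t w = block_iterate blk subgrad \<alpha> \<theta>0 t (\<lambda>s. S s w)" if "w \<in> space M" for t w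
    using that
  proof (induction t)
    case (Suc t)
    then show ?case
      by (simp add: coord sel_indicator_def vec_eq_iff[of "\<theta> (Suc t) w"] Let_def cong: if_cong)
  qed (simp add: initial)
  \<comment> \<open>Here \<open>h\<close> is arbitrary and may involve \<open>subgrad\<close>: only
    its composition with the map from finite histories to iterates enters.\<close>
  have history: "h (\<theta> t w) =
      (h \<circ> block_iterate blk subgrad \<alpha> \<theta>0 t) (restrict (\<lambda>s. S s w) {..<t})"
    if "w \<in> space M" for h :: "real ^ 'm \<Rightarrow> real" and t w
    by (simp add: block_iterate_restrict iterate[OF that])
  have int: "integrable M (\<lambda>w. h (\<theta> t w))" for h :: "real ^ 'm \<Rightarrow> real" and t
    using integrable_history by (subst Bochner_Integration.integrable_cong[OF refl history]) auto
  have selected: "expectation (\<lambda>w. sel_indicator S l t w * h (\<theta> t w)) =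
      \<sigma> l * expectation (\<lambda>w. h (\<theta> t w))"
    if "l \<in> {1..B}" for h :: "real ^ 'm \<Rightarrow> real" and t l
  proof -
    let ?h = "\<lambda>w. (h \<circ> block_iterate blk subgrad \<alpha> \<theta>0 t) (restrict (\<lambda>s. S s w) {..<t})"
    have "expectation (\<lambda>w. sel_indicator S l t w * h (\<theta> t w)) =
        expectation (\<lambda>w. sel_indicator S l t w * ?h w)"
      by (intro Bochner_Integration.integral_cong refl) (simp only: history)
    also have "\<dots> = \<sigma> l * expectation ?h" by (rule expectation_selected[OF that])
    also have "expectation ?h = expectation (\<lambda>w. h (\<theta> t w))"
      by (intro Bochner_Integration.integral_cong refl) (simp only: history)
    finally show ?thesis .
  qed

  \<comment> \<open>Expected descent of the weighted squared distance\<close>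
  define V where "V x = (\<Sum>i\<in>UNIV. (x $ i - \<theta>star $ i)\<^sup>2 / \<sigma> (blk i))" for x
  have V_nonneg: "0 \<le> V x" for x
    unfolding V_def using sel_prob_pos[OF blocks] by (intro sum_nonneg divide_nonneg_pos) auto
  have descent: "expectation (\<lambda>w. V (\<theta> (Suc t) w)) \<le>
      expectation (\<lambda>w. V (\<theta> t w)) - expectation (\<lambda>w. 2 * \<alpha> t * (\<phi> (\<theta> t w) - \<phi>star))
        + G\<^sup>2 * (\<alpha> t)\<^sup>2" for t
  proof -
    \<comment> \<open>\<open>X i\<close> is the change of the squared error in coordinate
      \<open>i\<close> when its block is selected.\<close>
    define X where "X i x = (\<alpha> t)\<^sup>2 * (subgrad x $ i)\<^sup>2
        - 2 * \<alpha> t * (subgrad x $ i * (x $ i - \<theta>star $ i))" for i x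
    have square: "(\<theta> (Suc t) w $ i - \<theta>star $ i)\<^sup>2 =
        (\<theta> t w $ i - \<theta>star $ i)\<^sup>2 + sel_indicator S (blk i) t w * X i (\<theta> t w)"
      if "w \<in> space M" for i w
      unfolding coord[OF that] X_def
      by (simp add: sel_indicator_def power2_eq_square algebra_simps)
    \<comment> \<open>The factor \<open>\<sigma> (blk i)\<close> from \<open>selected\<close>
      cancels the weight, so in expectation each coordinate contributes as if it were always
      updated.\<close>
    have summand: "expectation (\<lambda>w. (\<theta> (Suc t) w $ i - \<theta>star $ i)\<^sup>2 / \<sigma> (blk i)) =
        expectation (\<lambda>w. (\<theta> t w $ i - \<theta>star $ i)\<^sup>2 / \<sigma> (blk i) + X i (\<theta> t w))" for i
    proof -
      have pos: "0 < \<sigma> (blk i)" by (rule sel_prob_pos[OF blocks])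
      \<comment> \<open>The product depends on the selection at time \<open>t\<close>, hence is not
        covered by \<open>int\<close> at \<open>t\<close>. It is the difference of two squared
        errors, which \<open>int\<close> covers at \<open>Suc t\<close> and at
        \<open>t\<close>.\<close>
      have Xint: "integrable M (\<lambda>w. sel_indicator S (blk i) t w * X i (\<theta> t w))"
      proof -
        have "integrable M (\<lambda>w. (\<theta> (Suc t) w $ i - \<theta>star $ i)\<^sup>2 - (\<theta> t w $ i - \<theta>star $ i)\<^sup>2)"
          using int[of "\<lambda>x. (x $ i - \<theta>star $ i)\<^sup>2"] by auto
        also have "?this \<longleftrightarrow> ?thesis"
          by (intro Bochner_Integration.integrable_cong refl) (simp add: square)
        finally show ?thesis .
      qed
      have "expectation (\<lambda>w. (\<theta> (Suc t) w $ i - \<theta>star $ i)\<^sup>2) =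
          expectation (\<lambda>w. (\<theta> t w $ i - \<theta>star $ i)\<^sup>2 + sel_indicator S (blk i) t w * X i (\<theta> t w))"
        by (intro Bochner_Integration.integral_cong refl square)
      also have "\<dots> = expectation (\<lambda>w. (\<theta> t w $ i - \<theta>star $ i)\<^sup>2)
          + \<sigma> (blk i) * expectation (\<lambda>w. X i (\<theta> t w))"
        using Xint int[of "\<lambda>x. (x $ i - \<theta>star $ i)\<^sup>2"] selected[OF blocks, of i t "X i"] by simp
      finally have "expectation (\<lambda>w. (\<theta> (Suc t) w $ i - \<theta>star $ i)\<^sup>2) = \<dots>" .
      then show ?thesis
        using pos int[of "X i" t] int[of "\<lambda>x. (x $ i - \<theta>star $ i)\<^sup>2" t]
        by (simp add: field_simps)
    qed
    have "expectation (\<lambda>w. V (\<theta> (Suc t) w)) =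
        (\<Sum>i\<in>UNIV. expectation (\<lambda>w. (\<theta> (Suc t) w $ i - \<theta>star $ i)\<^sup>2 / \<sigma> (blk i)))"
      unfolding V_def using int[of "\<lambda>x. (x $ _ - \<theta>star $ _)\<^sup>2 / \<sigma> (blk _)"]
      by (intro Bochner_Integration.integral_sum)
    also have "\<dots> = (\<Sum>i\<in>UNIV.
        expectation (\<lambda>w. (\<theta> t w $ i - \<theta>star $ i)\<^sup>2 / \<sigma> (blk i) + X i (\<theta> t w)))"
      by (simp only: summand)
    also have "\<dots> = expectation (\<lambda>w. \<Sum>i\<in>UNIV.
        ((\<theta> t w $ i - \<theta>star $ i)\<^sup>2 / \<sigma> (blk i) + X i (\<theta> t w)))"
      using int[of "\<lambda>x. (x $ _ - \<theta>star $ _)\<^sup>2 / \<sigma> (blk _) + X _ x"]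
      by (intro Bochner_Integration.integral_sum[symmetric])
    also have "\<dots> \<le> expectation (\<lambda>w. V (\<theta> t w) - 2 * \<alpha> t * (\<phi> (\<theta> t w) - \<phi>star)
        + G\<^sup>2 * (\<alpha> t)\<^sup>2)"
    proof (rule integral_mono)
      fix w
      let ?x = "\<theta> t w"
      have "(\<Sum>i\<in>UNIV. X i ?x) =
          (\<alpha> t)\<^sup>2 * (norm (subgrad ?x))\<^sup>2 - 2 * \<alpha> t * (subgrad ?x \<bullet> (?x - \<theta>star))"
        unfolding X_def power2_norm_eq_inner inner_vec_def sum_subtractf sum_distrib_left
        by (simp add: power2_eq_square)
      moreover have "(\<alpha> t)\<^sup>2 * (norm (subgrad ?x))\<^sup>2 \<le> (\<alpha> t)\<^sup>2 * G\<^sup>2"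
        using G by (intro mult_left_mono power_mono) auto
      \<comment> \<open>The subgradient inequality at the iterate, tested at the minimizer.\<close>
      moreover have "2 * \<alpha> t * (\<phi> ?x - \<phi>star) \<le> 2 * \<alpha> t * (subgrad ?x \<bullet> (?x - \<theta>star))"
        using sub[of ?x \<theta>star] stepsize_nonneg[of t] optimal_solution
        by (intro mult_left_mono) (auto simp: inner_diff_right)
      ultimately show "(\<Sum>i\<in>UNIV. ((\<theta> t w $ i - \<theta>star $ i)\<^sup>2 / \<sigma> (blk i) + X i (\<theta> t w)))
          \<le> V ?x - 2 * \<alpha> t * (\<phi> ?x - \<phi>star) + G\<^sup>2 * (\<alpha> t)\<^sup>2"
        unfolding sum.distrib V_def mult.commute[of "G\<^sup>2"] by linarith
    next
      show "integrable M (\<lambda>w. \<Sum>i\<in>UNIV.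
          ((\<theta> t w $ i - \<theta>star $ i)\<^sup>2 / \<sigma> (blk i) + X i (\<theta> t w)))"
        by (rule int[of "\<lambda>x. \<Sum>i\<in>UNIV. ((x $ i - \<theta>star $ i)\<^sup>2 / \<sigma> (blk i) + X i x)"])
      show "integrable M (\<lambda>w. V (\<theta> t w) - 2 * \<alpha> t * (\<phi> (\<theta> t w) - \<phi>star) + G\<^sup>2 * (\<alpha> t)\<^sup>2)"
        by (rule int[of "\<lambda>x. V x - 2 * \<alpha> t * (\<phi> x - \<phi>star) + G\<^sup>2 * (\<alpha> t)\<^sup>2"])
    qed
    also have "\<dots> = expectation (\<lambda>w. V (\<theta> t w))
        - expectation (\<lambda>w. 2 * \<alpha> t * (\<phi> (\<theta> t w) - \<phi>star)) + G\<^sup>2 * (\<alpha> t)\<^sup>2"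
      using int[of V t] int[of "\<lambda>x. 2 * \<alpha> t * (\<phi> x - \<phi>star)" t]
      by (simp add: prob_space del: Bochner_Integration.integral_mult_right_zero)
    finally show ?thesis .
  qed

  \<comment> \<open>Almost sure summability of the weighted gaps\<close>
  have "AE w in M. summable (\<lambda>t. 2 * \<alpha> t * (\<phi> (\<theta> t w) - \<phi>star))"
  proof (rule AE_summable_if_expectation_bounded)
    show "integrable M (\<lambda>w. 2 * \<alpha> t * (\<phi> (\<theta> t w) - \<phi>star))" for t
      by (rule int[of "\<lambda>x. 2 * \<alpha> t * (\<phi> x - \<phi>star)"])
    show "0 \<le> 2 * \<alpha> t * (\<phi> (\<theta> t w) - \<phi>star)" for t w
      using lower[of "\<theta> t w"] stepsize_nonneg[of t] by simp
    show "(\<Sum>t<n. expectation (\<lambda>w. 2 * \<alpha> t * (\<phi> (\<theta> t w) - \<phi>star))) \<le>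
        expectation (\<lambda>w. V (\<theta> 0 w)) + G\<^sup>2 * (\<Sum>t. (\<alpha> t)\<^sup>2)" for n
    proof -
      \<comment> \<open>\<open>descent\<close> telescopes. The \<open>V\<close> term at time
        \<open>n\<close> is kept for the induction and then dropped by nonnegativity.\<close>
      have "(\<Sum>t<n. expectation (\<lambda>w. 2 * \<alpha> t * (\<phi> (\<theta> t w) - \<phi>star))) \<le>
        expectation (\<lambda>w. V (\<theta> 0 w)) - expectation (\<lambda>w. V (\<theta> n w)) + G\<^sup>2 * (\<Sum>t<n. (\<alpha> t)\<^sup>2)"
      proof (induction n)
        case (Suc n)
        then show ?case using descent[of n] by (simp only: sum.lessThan_Suc distrib_left)
      qed simp
      moreover have "0 \<le> expectation (\<lambda>w. V (\<theta> n w))"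
        by (intro Bochner_Integration.integral_nonneg V_nonneg)
      moreover have "G\<^sup>2 * (\<Sum>t<n. (\<alpha> t)\<^sup>2) \<le> G\<^sup>2 * (\<Sum>t. (\<alpha> t)\<^sup>2)"
        using stepsize_square_sum by (intro mult_left_mono sum_le_suminf) auto
      ultimately show ?thesis by linarith
    qed
  qed

  \<comment> \<open>Convergence along a single sample path\<close>
  then show ?thesis
    using AE_space
  proof eventually_elim
    case (elim w)
    have step: "norm (\<theta> (Suc t) w - \<theta> t w) \<le> G * \<alpha> t" for t
    proof -
      \<comment> \<open>The actual step is the full subgradient step with the unselected coordinates
        set to zero.\<close>
      have "norm (\<theta> (Suc t) w - \<theta> t w) \<le> norm (\<alpha> t *\<^sub>R subgrad (\<theta> t w))"
        using elim(2) stepsize_nonneg[of t]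
        by (intro norm_le_componentwise_cart) (simp add: coord sel_indicator_def abs_mult)
      also have "\<dots> \<le> G * \<alpha> t"
        using mult_left_mono[OF G stepsize_nonneg] stepsize_nonneg[of t] by (simp add: mult.commute)
      finally show ?thesis .
    qed
    have "(\<lambda>t. \<phi> (\<theta> t w) - \<phi>star) \<longlonglongrightarrow> 0"
    proof (rule tendsto_zero_if_weighted_summable[OF _ stepsize_nonneg _ _ stepsize_sum])
      show "0 \<le> \<phi> (\<theta> t w) - \<phi>star" for t using lower[of "\<theta> t w"] by simp
      \<comment> \<open>One factor \<open>G\<close> is the Lipschitz constant of
        \<open>\<phi>\<close>, the other bounds the length of a step per unit of step size.\<close>
      show "\<bar>\<phi> (\<theta> (Suc t) w) - \<phi>star - (\<phi> (\<theta> t w) - \<phi>star)\<bar> \<le> G * G * \<alpha> t" for t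
        using lipschitz[of "\<theta> (Suc t) w" "\<theta> t w"] mult_left_mono[OF step[of t] G_nonneg]
        by simp
      show "summable (\<lambda>t. \<alpha> t * (\<phi> (\<theta> t w) - \<phi>star))"
        using summable_mult[OF elim(1), of "1/2"] by (simp add: mult.assoc)
    qed
    then show ?case by (simp add: LIM_zero_iff)
  qed
qed

end
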